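(* Let $S$ be a polynomial ring over a field, let $\Delta$ be a simplicial tree whose vertices are labeled by monomials $m_1,\ldots,m_t \in S$, and let $I=(m_1,\ldots,m_t)$ be the ideal of $S$ generated by the vertex labels. Then the chain complex $\mathcal{C}(\Delta)=\mathcal{C}(\Delta;S)$ is a free resolution of $S/I$ if and only if the induced subcomplex $\Delta_m$ is connected for every monomial $m\in S$ (where the empty complex is counted as connected).
   Context: A simplicial complex $\Delta$ on a nonempty finite vertex set $V=\{v_1,\ldots,v_n\}$ is a collection of subsets of $V$ (faces), closed under taking subsets, with $\{v_i\}\in\Delta$ for all $i$. Facets are the faces maximal under inclusion. A subcollection of $\Delta$ is a simplicial complex generated by a subset of the set of facets of $\Delta$. A facet $F$ of a simplicial complex is a leaf if either it is the only facet, or there is a facet $G\neq F$ such that $F\cap H\subseteq G$ for every facet $H\neq F$. A simplicial tree is a connected simplicial complex such that every nonempty subcollection (i.e. generated by a nonempty set of facets) has a leaf. Labeling: the vertices of $\Delta$ are $1,\ldots,t$, vertex $i$ has label $m_i$, and each face $A$ of $\Delta$ is labeled by $m_A=\mathrm{lcm}(m_i : i\in A)$, with $m_\emptyset=1$. For a monomial $m\in S$, $\Delta_m$ is the subcomplex of $\Delta$ induced on the vertices whose labels divide $m$, i.e. the set of all faces of $\Delta$ all of whose vertices have labels dividing $m$; it is called empty if it has no vertices. The chain complex $\mathcal{C}(\Delta;S)$ is the complex of free $S$-modules with basis $\{e_A : A\in\Delta\}$ (including $A=\emptyset$), where $e_A$ is in homological degree $|A|$, and with differential $\partial(e_A)=\sum_{i\in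 A}\mathrm{sign}(i,A)\,\frac{m_A}{m_{A\setminus\{i\}}}\,e_{A\setminus\{i\}}$, where $\mathrm{sign}(i,A)=(-1)^{k-1}$ if $i$ is the $k$-th smallest element of $A$. It is a free resolution of $S/I$ when it is exact in all positive homological degrees (its cokernel in degree $0$ is $S/I$). *)

theory Defs
  imports Complex_Main "HOL-Library.Poly_Mapping"
begin

section \<open>Simplicial complexes and simplicial trees\<close>

definition simplicial_complex :: "'v set \<Rightarrow> 'v set set \<Rightarrow> bool" where
  "simplicial_complex V \<Delta> \<longleftrightarrow>
     finite V \<and> V \<noteq> {} \<and> \<Delta> \<subseteq> Pow V \<and>
     (\<forall>A\<in>\<Delta>. \<forall>B. B \<subseteq> A \<longrightarrow> B \<in> \<Delta>) \<and> (\<forall>v\<in>V. {v} \<in> \<Delta>)"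

definition facets :: "'v set set \<Rightarrow> 'v set set" where
  "facets \<Delta> = {F \<in> \<Delta>. \<forall>G\<in>\<Delta>. F \<subseteq> G \<longrightarrow> G = F}"

definition generated_complex :: "'v set set \<Rightarrow> 'v set set" where
  "generated_complex Q = {A. \<exists>F\<in>Q. A \<subseteq> F}"

definition is_leaf :: "'v set set \<Rightarrow> 'v set \<Rightarrow> bool" where
  "is_leaf \<Delta> F \<longleftrightarrow>
     F \<in> facets \<Delta> \<and>
     (facets \<Delta> = {F} \<or>
      (\<exists>G\<in>facets \<Delta>. G \<noteq> F \<and> (\<forall>H\<in>facets \<Delta>. H \<noteq> F \<longrightarrow> F \<inter> H \<subseteq> G)))"

text \<open>
  Connectedness means that any two vertices are joined by a path of edges. Consecutive
  vertices of a path may coincide, which is harmless. A complex without vertices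
  (\<open>{}\<close> or \<open>{{}}\<close>) counts as connected.
\<close>

definition connected_complex :: "'v set set \<Rightarrow> bool" where
  "connected_complex \<Delta> \<longleftrightarrow>
     (\<forall>u v. {u} \<in> \<Delta> \<longrightarrow> {v} \<in> \<Delta> \<longrightarrow> (u, v) \<in> {(a, b). {a, b} \<in> \<Delta>}\<^sup>*)"

definition simplicial_tree :: "'v set \<Rightarrow> 'v set set \<Rightarrow> bool" where
  "simplicial_tree V \<Delta> \<longleftrightarrow>
     simplicial_complex V \<Delta> \<and> connected_complex \<Delta> \<and>
     (\<forall>Q. Q \<subseteq> facets \<Delta> \<longrightarrow> Q \<noteq> {} \<longrightarrow> (\<exists>F. is_leaf (generated_complex Q) F))"

definition induced_subcomplex :: "'v set set \<Rightarrow> 'v set \<Rightarrow> 'v set set" where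
  "induced_subcomplex \<Delta> W = {A \<in> \<Delta>. A \<subseteq> W}"


section \<open>Polynomial rings and monomials\<close>

text \<open>
  A monomial in the variables \<open>'x\<close> is represented by its exponent vector, of type
  \<open>'x \<Rightarrow>\<^sub>0 nat\<close>, so that the product of monomials is \<open>+\<close> and the monomial \<open>1\<close> is \<open>0\<close>.
  The polynomial ring is the monoid algebra, with the convolution product of
  \<^theory>\<open>HOL-Library.Poly_Mapping\<close>.
\<close>

type_synonym 'x monomial = "'x \<Rightarrow>\<^sub>0 nat"
type_synonym ('x, 'k) polynomial = "('x \<Rightarrow>\<^sub>0 nat) \<Rightarrow>\<^sub>0 'k"

definition monom :: "'x monomial \<Rightarrow> ('x, 'k::comm_ring_1) polynomial" where
  "monom u = Poly_Mapping.single u 1"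

text \<open>The library order on \<open>'x \<Rightarrow>\<^sub>0 nat\<close> is lexicographic, hence not divisibility.\<close>

lemma monom_dvd_iff:
  "(monom u :: ('x, 'k::comm_ring_1) polynomial) dvd monom v \<longleftrightarrow>
     (\<forall>x. Poly_Mapping.lookup u x \<le> Poly_Mapping.lookup v x)"
proof
  assume "(monom u :: ('x, 'k) polynomial) dvd monom v"
  then obtain q :: "('x, 'k) polynomial" where q: "monom v = monom u * q" by (elim dvdE)
  have "v \<in> Poly_Mapping.keys (monom v :: ('x, 'k) polynomial)"
    by (simp add: monom_def)
  then have "v \<in> Poly_Mapping.keys (monom u * q)" using q by simp
  then obtain w where "v = u + w"
    using keys_mult[of "monom u" q] by (auto simp: monom_def split: if_splits)
  then show "\<forall>x. Poly_Mapping.lookup u x \<le> Poly_Mapping.lookup v x"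
    by (simp add: lookup_add)
next
  assume le: "\<forall>x. Poly_Mapping.lookup u x \<le> Poly_Mapping.lookup v x"
  have "v = u + (v - u)"
    by (rule poly_mapping_eqI) (simp add: lookup_add lookup_minus le)
  then have "(monom v :: ('x, 'k) polynomial) = monom u * monom (v - u)"
    unfolding monom_def mult_single by simp
  then show "(monom u :: ('x, 'k) polynomial) dvd monom v" by (rule dvdI)
qed

text \<open>
  The least common multiple of the monomials \<open>\<mu> i\<close>, for \<open>i\<close> in a finite set \<open>A\<close>, has
  as exponents the maxima of the exponents. For \<open>A = {}\<close> it is the monomial \<open>1\<close>.
\<close>

definition lcm_label :: "('v \<Rightarrow> 'x monomial) \<Rightarrow> 'v set \<Rightarrow> 'x monomial" where
  "lcm_label \<mu> A =
     (\<Sum>x\<in>(\<Union>i\<in>A. Poly_Mapping.keys (\<mu> i)).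
        Poly_Mapping.single x (MAX i\<in>A. Poly_Mapping.lookup (\<mu> i) x))"

lemma lookup_lcm_label:
  assumes "finite A" "A \<noteq> {}"
  shows "Poly_Mapping.lookup (lcm_label \<mu> A) x = (MAX i\<in>A. Poly_Mapping.lookup (\<mu> i) x)"
proof -
  let ?K = "\<Union>i\<in>A. Poly_Mapping.keys (\<mu> i)"
  have "finite ?K" using assms by simp
  then have eq: "Poly_Mapping.lookup (lcm_label \<mu> A) x =
      (if x \<in> ?K then (MAX i\<in>A. Poly_Mapping.lookup (\<mu> i) x) else 0)"
    by (simp add: lcm_label_def lookup_sum lookup_single when_def)
  show ?thesis
  proof (cases "x \<in> ?K")
    case False
    then have "(\<lambda>i. Poly_Mapping.lookup (\<mu> i) x) ` A = {0}"
      using assms(2) by (auto simp: in_keys_iff)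
    then show ?thesis using eq False by simp
  qed (use eq in simp)
qed

lemma lcm_label_dvd_iff:
  assumes "finite A"
  shows "(monom (lcm_label \<mu> A) :: ('x, 'k::comm_ring_1) polynomial) dvd monom m \<longleftrightarrow>
    (\<forall>i\<in>A. (monom (\<mu> i) :: ('x, 'k) polynomial) dvd monom m)"
proof (cases "A = {}")
  case True
  then show ?thesis by (simp add: monom_dvd_iff lcm_label_def)
next
  case False
  then show ?thesis
    using assms by (auto simp: monom_dvd_iff lookup_lcm_label)
qed


section \<open>The labeled chain complex\<close>

text \<open>
  The free module with basis \<open>e\<^sub>A\<close>, \<open>A\<close> a face with \<open>card A = d\<close>, over the polynomial
  ring consists of the finitely supported maps from faces to polynomials, with
  \<open>e\<^sub>A = Poly_Mapping.single A 1\<close>. Degree \<open>0\<close> is spanned by \<open>e\<close> of the empty face.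
\<close>

definition chains ::
    "nat set set \<Rightarrow> nat \<Rightarrow> (nat set \<Rightarrow>\<^sub>0 ('x, 'k::comm_ring_1) polynomial) set" where
  "chains \<Delta> d = {c. Poly_Mapping.keys c \<subseteq> {A \<in> \<Delta>. card A = d}}"

text \<open>If \<open>i\<close> is the \<open>k\<close>-th smallest element of \<open>A\<close>, then \<open>card {j \<in> A. j < i} = k - 1\<close>.\<close>

definition face_sign :: "nat \<Rightarrow> nat set \<Rightarrow> 'a::comm_ring_1" where
  "face_sign i A = (-1) ^ card {j \<in> A. j < i}"

text \<open>
  The difference of exponent vectors is the quotient of the monomials \<open>m\<^sub>A\<close> and
  \<open>m\<close> of \<open>A - {i}\<close>; no truncation occurs, because the latter divides the former.
\<close>

definition boundary ::
    "(nat \<Rightarrow> 'x monomial) \<Rightarrow> (nat set \<Rightarrow>\<^sub>0 ('x, 'k::comm_ring_1) polynomial)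
       \<Rightarrow> (nat set \<Rightarrow>\<^sub>0 ('x, 'k) polynomial)" where
  "boundary \<mu> c =
     (\<Sum>A\<in>Poly_Mapping.keys c. \<Sum>i\<in>A. Poly_Mapping.single (A - {i})
        (Poly_Mapping.lookup c A *
          (face_sign i A * monom (lcm_label \<mu> A - lcm_label \<mu> (A - {i})))))"

lemma boundary_basis:
  "boundary \<mu> (Poly_Mapping.single A (1 :: ('x, 'k::comm_ring_1) polynomial)) =
     (\<Sum>i\<in>A. Poly_Mapping.single (A - {i})
        (face_sign i A * monom (lcm_label \<mu> A - lcm_label \<mu> (A - {i}))))"
  by (simp add: boundary_def)

lemma boundary_add: "boundary \<mu> (c + c') = boundary \<mu> c + boundary \<mu> c'"
proof -
  let ?t = "\<lambda>c A. \<Sum>i\<in>A. Poly_Mapping.single (A - {i})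
        (Poly_Mapping.lookup c A *
          (face_sign i A * monom (lcm_label \<mu> A - lcm_label \<mu> (A - {i}))))"
  let ?K = "Poly_Mapping.keys c \<union> Poly_Mapping.keys c'"
  have ext: "boundary \<mu> b = sum (?t b) ?K" if "Poly_Mapping.keys b \<subseteq> ?K" for b
    unfolding boundary_def
    by (rule sum.mono_neutral_left) (use that in \<open>auto simp: in_keys_iff\<close>)
  have "sum (?t (c + c')) ?K = sum (?t c) ?K + sum (?t c') ?K"
    by (simp add: lookup_add distrib_right single_add sum.distrib)
  then show ?thesis
    using ext[of "c + c'"] ext[of c] ext[of c'] keys_add[of c c'] by simp
qed

text \<open>The ideal generated by \<open>G\<close> is the span of \<open>G\<close> in the ring as a module over itself.\<close>

abbreviation ideal_generated_by :: "'a::comm_ring_1 set \<Rightarrow> 'a set" where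
  "ideal_generated_by G \<equiv> module.span (*) G"

text \<open>
  The complex is exact in all positive degrees, and the identification of degree \<open>0\<close>
  with the polynomial ring induces an isomorphism of the cokernel with its quotient by
  \<open>I\<close>, that is, the image of the differential in degree \<open>0\<close> is \<open>I\<close>.
\<close>

definition is_free_resolution_of_quotient ::
    "nat set set \<Rightarrow> (nat \<Rightarrow> 'x monomial) \<Rightarrow> ('x, 'k::comm_ring_1) polynomial set \<Rightarrow> bool" where
  "is_free_resolution_of_quotient \<Delta> \<mu> I \<longleftrightarrow>
     (\<forall>d\<ge>1. {c \<in> chains \<Delta> d. boundary \<mu> c = (0 :: nat set \<Rightarrow>\<^sub>0 ('x, 'k) polynomial)}
              = boundary \<mu> ` chains \<Delta> (d + 1)) \<and>
     boundary \<mu> ` chains \<Delta> 1 = {c \<in> chains \<Delta> 0. Poly_Mapping.lookup c {} \<in> I}"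

end

theory Submission
  imports Defs
begin

text \<open>
  The labeled complex is multigraded, with \<open>u e\<^sub>A\<close> in multidegree \<open>u m\<^sub>A\<close>, and its part of
  multidegree \<open>m\<close> is the augmented simplicial chain complex of \<open>\<Delta>\<^sub>m\<close> over the coefficient
  ring. So it is a resolution iff every \<open>\<Delta>\<^sub>m\<close> is acyclic (the empty complex being allowed).
  Exactness at the vertices is connectedness of \<open>\<Delta>\<^sub>m\<close>. Above that there is no condition:
  peeling off leaves orders the facets of a tree so that each one meets the union of its
  predecessors in a single simplex, this property is inherited by induced subcomplexes,
  and a Mayer-Vietoris argument along the order kills all higher cycles.
\<close>


section \<open>Simplicial chains with scalar coefficients\<close>

text \<open>
  Since \<open>face_sign i\<close> does not see \<open>i\<close> itself, \<open>face_sign i B\<close> is the sign of \<open>i\<close> in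
  \<open>insert i B\<close>.
\<close>

definition boundary_in :: "nat set \<Rightarrow> (nat set \<Rightarrow> 'k::comm_ring_1) \<Rightarrow> nat set \<Rightarrow> 'k" where
  "boundary_in V f B = (\<Sum>i\<in>V - B. face_sign i B * f (insert i B))"

text \<open>Left multiplication by \<open>e\<^sub>v\<close> in the exterior algebra;
  \<open>face_sign v A\<close> is the sign of moving \<open>v\<close> into its place.\<close>

definition cone :: "nat \<Rightarrow> (nat set \<Rightarrow> 'k::comm_ring_1) \<Rightarrow> nat set \<Rightarrow> 'k" where
  "cone v f A = (if v \<in> A then face_sign v A * f (A - {v}) else 0)"

text \<open>Chains are functions on all sets and the complex only bounds their support, so chains of
  different complexes can be added directly.\<close>

definition scalar_chains :: "nat set set \<Rightarrow> nat \<Rightarrow> (nat set \<Rightarrow> 'k::zero) set" where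
  "scalar_chains K d = {f. \<forall>A. f A \<noteq> 0 \<longrightarrow> A \<in> K \<and> card A = d}"

text \<open>The degree is the cardinality, so \<open>d = 1\<close> concerns the vertices, and the
  empty face makes the complex augmented. The phantom argument fixes the coefficient ring, which no
  other argument mentions.\<close>

definition acyclic_at :: "'k::comm_ring_1 itself \<Rightarrow> nat set \<Rightarrow> nat set set \<Rightarrow> nat \<Rightarrow> bool" where
  "acyclic_at _ V K d \<longleftrightarrow>
     (\<forall>f \<in> scalar_chains K d. (\<forall>B. boundary_in V f B = (0::'k)) \<longrightarrow>
        (\<exists>g \<in> scalar_chains K (Suc d). \<forall>B. boundary_in V g B = f B))"

section \<open>Signs and cancellation in pairs\<close>

lemma face_sign_insert:
  assumes "j \<notin> B"
  shows "(face_sign i (insert j B) :: 'a::comm_ring_1) =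
    (if j < i then - face_sign i B else face_sign i B)"
proof (cases "j < i")
  case True
  then have "{k \<in> insert j B. k < i} = insert j {k \<in> B. k < i}" by auto
  then show ?thesis using assms True by (simp add: face_sign_def)
next
  case False
  then have "{k \<in> insert j B. k < i} = {k \<in> B. k < i}" by auto
  then show ?thesis using False by (simp add: face_sign_def)
qed

lemma face_sign_insert_self [simp]: "face_sign i (insert i B) = face_sign i B"
  unfolding face_sign_def by (rule arg_cong[where f = "\<lambda>X. (-1) ^ card X"]) auto

lemma face_sign_mult_self [simp]: "face_sign i B * face_sign i B = (1 :: 'a::comm_ring_1)"
  by (simp add: face_sign_def flip: power_mult_distrib)

text \<open>Exactly one of \<open>i < j\<close> and \<open>j < i\<close> holds, so exactly one of
  the two insertions flips the sign of the other element.\<close>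

lemma face_sign_swap:
  assumes "i \<notin> B" "j \<notin> B" "i \<noteq> j"
  shows "face_sign i B * face_sign j (insert i B) =
    - (face_sign j B * face_sign i (insert j B) :: 'a::comm_ring_1)"
  using assms by (auto simp: face_sign_insert)

text \<open>The terms at \<open>(i, j)\<close> and \<open>(j, i)\<close> cancel. Comparing the sum
  with its negative would only show that twice the sum is \<open>0\<close>, which is too weak in
  characteristic 2; hence the induction.\<close>

lemma sum_antisymmetric:
  fixes a :: "'b \<Rightarrow> 'b \<Rightarrow> 'a::ab_group_add"
  assumes "finite X" "\<And>i j. i \<in> X \<Longrightarrow> j \<in> X \<Longrightarrow> i \<noteq> j \<Longrightarrow> a i j = - a j i"
  shows "(\<Sum>i\<in>X. \<Sum>j\<in>X - {i}. a i j) = 0"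
  using assms
proof (induction X rule: finite_induct)
  case (insert x X)
  have "(\<Sum>j\<in>insert x X - {i}. a i j) = a i x + (\<Sum>j\<in>X - {i}. a i j)" if "i \<in> X" for i
  proof -
    have "insert x X - {i} = insert x (X - {i})" using insert.hyps that by auto
    then show ?thesis using insert.hyps by simp
  qed
  moreover have "(\<Sum>i\<in>X. \<Sum>j\<in>X - {i}. a i j) = 0"
    by (rule insert.IH) (rule insert.prems; simp)
  moreover have "insert x X - {x} = X" using insert.hyps by auto
  moreover have "(\<Sum>j\<in>X. a x j) = - (\<Sum>i\<in>X. a i x)"
    unfolding sum_negf[symmetric]
    by (rule sum.cong[OF refl], rule insert.prems) (use insert.hyps in auto)
  ultimately show ?case using insert.hyps by (simp add: sum.distrib)
qed simp

section \<open>The boundary operator: linearity, vanishing square and cones\<close>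

lemma boundary_in_add:
  "boundary_in V (\<lambda>A. f A + g A) B = boundary_in V f B + boundary_in V g B"
  by (simp add: boundary_in_def distrib_left sum.distrib)

lemma boundary_in_diff:
  "boundary_in V (\<lambda>A. f A - g A) B = boundary_in V f B - boundary_in V g B"
  by (simp add: boundary_in_def right_diff_distrib sum_subtractf)

lemma boundary_in_sum:
  "boundary_in V (\<lambda>A. \<Sum>v\<in>S. a v * g v A) B = (\<Sum>v\<in>S. a v * boundary_in V (g v) B)"
proof -
  have "boundary_in V (\<lambda>A. \<Sum>v\<in>S. a v * g v A) B =
      (\<Sum>i\<in>V - B. \<Sum>v\<in>S. a v * (face_sign i B * g v (insert i B)))"
    by (simp add: boundary_in_def sum_distrib_left mult.left_commute)
  also have "\<dots> = (\<Sum>v\<in>S. \<Sum>i\<in>V - B. a v * (face_sign i B * g v (insert i B)))"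
    by (rule sum.swap)
  finally show ?thesis by (simp add: boundary_in_def sum_distrib_left)
qed

text \<open>The two orders of adding \<open>i\<close> and \<open>j\<close> to \<open>B\<close> reach
  the same set with opposite signs, so the double sum is antisymmetric.\<close>

lemma boundary_in_boundary_in:
  assumes "finite V"
  shows "boundary_in V (boundary_in V f) B = 0"
proof -
  have "boundary_in V (boundary_in V f) B = (\<Sum>i\<in>V - B. \<Sum>j\<in>V - B - {i}.
      face_sign i B * face_sign j (insert i B) * f (insert j (insert i B)))"
    by (simp add: boundary_in_def sum_distrib_left mult.assoc Diff_insert[symmetric]
        insert_commute)
  also have "\<dots> = 0"
  proof (rule sum_antisymmetric)
    fix i j assume "i \<in> V - B" "j \<in> V - B" "i \<noteq> j"
    then show "face_sign i B * face_sign j (insert i B) * f (insert j (insert i B)) =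
        - (face_sign j B * face_sign i (insert j B) * f (insert i (insert j B)))"
      using face_sign_swap[of i B j, where 'a='a] by (simp add: insert_commute)
  qed (use assms in simp)
  finally show ?thesis .
qed

text \<open>Coning with apex \<open>v\<close> is a contracting homotopy of the full simplex on
  \<open>V\<close>. If \<open>v\<close> is not in \<open>B\<close>, only \<open>i = v\<close>
  contributes to the first summand and the second vanishes.\<close>

lemma cone_homotopy:
  assumes "finite V" "v \<in> V"
  shows "boundary_in V (cone v f) B + cone v (boundary_in V f) B = f B"
proof (cases "v \<in> B")
  case False
  have "boundary_in V (cone v f) B =
      (\<Sum>i\<in>V - B. if i = v then face_sign v B * (face_sign v (insert v B) * f B) else 0)"
    unfolding boundary_in_def using False
    by (intro sum.cong) (auto simp: cone_def)
  also have "\<dots> = f B"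
    using assms False by (simp add: mult.assoc[symmetric])
  finally show ?thesis using False by (simp add: cone_def)
next
  case True
  \<comment> \<open>\<open>C\<close> is the face opposite the apex. In the boundary of
    \<open>f\<close> at \<open>C\<close> the term \<open>i = v\<close> yields \<open>f B\<close>;
    the remaining ones cancel the boundary of the cone at \<open>B\<close>.\<close>
  define C where "C = B - {v}"
  have B: "B = insert v C" and vC: "v \<notin> C" using True by (auto simp: C_def)
  have VC: "V - C = insert v (V - B)" "v \<notin> V - B" using assms vC by (auto simp: B)
  have "cone v (boundary_in V f) B = face_sign v C * boundary_in V f C"
    using vC by (simp add: cone_def B)
  also have "\<dots> = f B + (\<Sum>i\<in>V - B. face_sign v C * (face_sign i C * f (insert i C)))"
    unfolding boundary_in_def VC(1) using VC(2) assms
    by (simp add: distrib_left sum_distrib_left mult.assoc[symmetric] B)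
  also have "(\<Sum>i\<in>V - B. face_sign v C * (face_sign i C * f (insert i C))) =
      - boundary_in V (cone v f) B"
    unfolding boundary_in_def sum_negf[symmetric]
  proof (rule sum.cong)
    fix i assume i: "i \<in> V - B"
    then have iv: "i \<noteq> v" "i \<notin> C" by (auto simp: B)
    have "insert i B - {v} = insert i C" using iv vC by (auto simp: B)
    moreover have "face_sign v (insert i B) = (face_sign v (insert i C) :: 'a)"
      using face_sign_insert_self[of v "insert i C"] by (simp only: B insert_commute)
    ultimately have c: "cone v f (insert i B) = face_sign v (insert i C) * f (insert i C)"
      using True by (simp add: cone_def)
    show "face_sign v C * (face_sign i C * f (insert i C)) =
        - (face_sign i B * cone v f (insert i B))"
      unfolding c using iv vC by (auto simp: B face_sign_insert)
  qed simp
  finally show ?thesis by simp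
qed

section \<open>Chains supported on a complex, and acyclicity of simplices\<close>

lemma scalar_chainsD:
  assumes "f \<in> scalar_chains K d" "f A \<noteq> 0"
  shows "A \<in> K" "card A = d"
  using assms by (auto simp: scalar_chains_def)

lemma scalar_chains_mono:
  assumes "f \<in> scalar_chains K d" "K \<subseteq> K'"
  shows "f \<in> scalar_chains K' d"
  using assms by (auto simp: scalar_chains_def)

lemma scalar_chains_add:
  fixes f g :: "nat set \<Rightarrow> 'k::comm_ring_1"
  assumes "f \<in> scalar_chains K d" "g \<in> scalar_chains K d"
  shows "(\<lambda>A. f A + g A) \<in> scalar_chains K d"
proof -
  have "A \<in> K \<and> card A = d" if "f A + g A \<noteq> 0" for A
    using that scalar_chainsD[OF assms(1), of A] scalar_chainsD[OF assms(2), of A] by fastforce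
  then show ?thesis by (simp add: scalar_chains_def)
qed

lemma scalar_chains_diff:
  fixes f g :: "nat set \<Rightarrow> 'k::comm_ring_1"
  assumes "f \<in> scalar_chains K d" "g \<in> scalar_chains K d"
  shows "(\<lambda>A. f A - g A) \<in> scalar_chains K d"
proof -
  have "(\<lambda>A. - g A) \<in> scalar_chains K d" using assms(2) by (simp add: scalar_chains_def)
  from scalar_chains_add[OF assms(1) this] show ?thesis by simp
qed

lemma acyclic_atE:
  fixes f :: "nat set \<Rightarrow> 'k::comm_ring_1"
  assumes "acyclic_at TYPE('k) V K d" "f \<in> scalar_chains K d" "\<And>B. boundary_in V f B = 0"
  obtains g where "g \<in> scalar_chains K (Suc d)" "\<And>B. boundary_in V g B = f B"
  using assms unfolding acyclic_at_def by blast

lemma boundary_in_scalar_chains: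
  assumes "f \<in> scalar_chains K (Suc d)" "\<And>A. A \<in> K \<Longrightarrow> finite A"
    and "\<And>A B. A \<in> K \<Longrightarrow> B \<subseteq> A \<Longrightarrow> B \<in> K"
  shows "boundary_in V f \<in> scalar_chains K d"
  unfolding scalar_chains_def
proof (clarsimp)
  fix B assume "boundary_in V f B \<noteq> 0"
  then obtain i where i: "i \<in> V - B" "f (insert i B) \<noteq> 0"
    unfolding boundary_in_def by (metis (no_types, lifting) mult_zero_right sum.neutral)
  then have "insert i B \<in> K" "card (insert i B) = Suc d"
    using scalar_chainsD[OF assms(1)] by auto
  then show "B \<in> K \<and> card B = d"
    using assms(2)[of "insert i B"] assms(3)[of "insert i B" B] i(1) by auto
qed

lemma cone_scalar_chains:
  assumes "f \<in> scalar_chains (Pow F) d" "finite F" "v \<in> F"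
  shows "cone v f \<in> scalar_chains (Pow F) (Suc d)"
  unfolding scalar_chains_def
proof (clarsimp)
  fix A assume "cone v f A \<noteq> 0"
  then have A: "v \<in> A" "f (A - {v}) \<noteq> 0" by (auto simp: cone_def split: if_splits)
  have "A - {v} \<subseteq> F" "card (A - {v}) = d" using scalar_chainsD[OF assms(1) A(2)] by auto
  moreover from this have "A \<subseteq> F" using assms(3) by auto
  ultimately show "A \<subseteq> F \<and> card A = Suc d"
    using A(1) assms(2) by (metis card.remove finite_subset)
qed

lemma acyclic_at_no_faces:
  assumes "\<And>A. A \<in> K \<Longrightarrow> card A \<noteq> d"
  shows "acyclic_at TYPE('k::comm_ring_1) V K d"
  unfolding acyclic_at_def
proof (intro ballI impI bexI allI)
  fix f :: "nat set \<Rightarrow> 'k" and B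
  assume "f \<in> scalar_chains K d"
  then have "f B = 0" using assms by (auto simp: scalar_chains_def)
  then show "boundary_in V (\<lambda>_. 0) B = f B" by (simp add: boundary_in_def)
qed (simp add: scalar_chains_def)

text \<open>A simplex is a cone over any of its vertices, and on a cycle \<open>f\<close> the
  homotopy identity says that \<open>cone v f\<close> has boundary \<open>f\<close>. For
  \<open>F = {}\<close> there is no apex, and degree 0 does fail.\<close>

lemma acyclic_at_simplex:
  assumes "finite V" "F \<subseteq> V" "F \<noteq> {}"
  shows "acyclic_at TYPE('k::comm_ring_1) V (Pow F) d"
  unfolding acyclic_at_def
proof (intro ballI impI)
  fix f :: "nat set \<Rightarrow> 'k"
  assume f: "f \<in> scalar_chains (Pow F) d" "\<forall>B. boundary_in V f B = 0"
  obtain v where v: "v \<in> F" using assms by auto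
  have "boundary_in V (cone v f) B = f B" for B
    using cone_homotopy[of V v f B] v assms(1,2) f(2) by (auto simp: cone_def subset_iff split: if_splits)
  moreover have "cone v f \<in> scalar_chains (Pow F) (Suc d)"
    using cone_scalar_chains[OF f(1) _ v] assms finite_subset by blast
  ultimately show "\<exists>g\<in>scalar_chains (Pow F) (Suc d). \<forall>B. boundary_in V g B = f B" by blast
qed


section \<open>Complexes built by attaching leaves\<close>

text \<open>
  The members need not be pairwise incomparable: this makes the notion stable under
  intersecting all members with a fixed set, unlike the one phrased with facets.
\<close>

inductive leaf_order :: "'v set set \<Rightarrow> bool" where
  empty: "leaf_order {}"
| single: "leaf_order {F}"
| insert: "leaf_order Q \<Longrightarrow> G \<in> Q \<Longrightarrow> (\<And>H. H \<in> Q \<Longrightarrow> F \<inter> H \<subseteq> G) \<Longrightarrow> leaf_order (insert F Q)"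

text \<open>The condition \<open>F \<inter> H \<subseteq> G\<close> survives intersecting all three
  sets with \<open>W\<close>. Members that become equal do no harm, since the inserted set may
  already be present.\<close>

lemma leaf_order_restrict: "leaf_order Q \<Longrightarrow> leaf_order ((\<lambda>F. F \<inter> W) ` Q)"
proof (induction rule: leaf_order.induct)
  case (insert Q G F)
  then have "leaf_order (insert (F \<inter> W) ((\<lambda>F. F \<inter> W) ` Q))"
    by (intro leaf_order.insert[where G = "G \<inter> W"]) auto
  then show ?case by simp
qed (auto intro: leaf_order.intros)

text \<open>Facets are pairwise incomparable, so no member of \<open>Q\<close> is swallowed by
  another. Being a leaf of a subcollection thus becomes a condition on \<open>Q\<close>
  itself.\<close>

lemma facets_generated_complex:
  assumes "Q \<subseteq> facets \<Delta>"
  shows "facets (generated_complex Q) = Q"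
proof -
  have anti: "F = G" if "F \<in> Q" "G \<in> Q" "F \<subseteq> G" for F G
    using assms that by (auto simp: facets_def)
  show ?thesis
    unfolding facets_def generated_complex_def using anti by blast
qed

lemma generated_complex_facets:
  assumes "finite \<Delta>" "\<forall>A\<in>\<Delta>. Pow A \<subseteq> \<Delta>"
  shows "generated_complex (facets \<Delta>) = \<Delta>"
proof -
  have "\<exists>F \<in> facets \<Delta>. A \<subseteq> F" if "A \<in> \<Delta>" for A
  proof -
    obtain F where "F \<in> \<Delta>" "A \<subseteq> F" "\<forall>G\<in>\<Delta>. F \<subseteq> G \<longrightarrow> F = G"
      using finite_has_maximal2[OF assms(1) \<open>A \<in> \<Delta>\<close>] by blast
    then show ?thesis by (auto simp: facets_def)
  qed
  moreover have "facets \<Delta> \<subseteq> \<Delta>" by (auto simp: facets_def)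
  ultimately show ?thesis
    using assms(2) unfolding generated_complex_def by blast
qed

text \<open>The order is built from its end: a leaf of the collection is attached last, and what
  remains is again a set of facets, hence has a leaf. The induction therefore runs over all subsets
  of the facets.\<close>

lemma simplicial_tree_leaf_order:
  assumes "simplicial_tree V \<Delta>"
  shows "leaf_order (facets \<Delta>)"
proof -
  have "finite \<Delta>"
    using assms unfolding simplicial_tree_def simplicial_complex_def
    by (meson finite_Pow_iff finite_subset)
  then have fin: "finite (facets \<Delta>)" by (simp add: facets_def)
  have "leaf_order Q" if "Q \<subseteq> facets \<Delta>" for Q
    using finite_subset[OF that fin] that
  proof (induction Q rule: finite_psubset_induct)
    case (psubset Q)
    show ?case
    proof (cases "Q = {}")
      case False
      then obtain F where "is_leaf (generated_complex Q) F"
        using assms psubset.prems unfolding simplicial_tree_def by blast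
      then have F: "F \<in> Q"
        "Q = {F} \<or> (\<exists>G\<in>Q. G \<noteq> F \<and> (\<forall>H\<in>Q. H \<noteq> F \<longrightarrow> F \<inter> H \<subseteq> G))"
        unfolding is_leaf_def facets_generated_complex[OF psubset.prems] by auto
      have "leaf_order (Q - {F})"
        using F(1) psubset.prems by (intro psubset.IH) auto
      from F(2) show ?thesis
      proof
        assume "Q = {F}"
        then show ?thesis by (simp add: leaf_order.single)
      next
        assume "\<exists>G\<in>Q. G \<noteq> F \<and> (\<forall>H\<in>Q. H \<noteq> F \<longrightarrow> F \<inter> H \<subseteq> G)"
        then obtain G where "G \<in> Q - {F}" "\<And>H. H \<in> Q - {F} \<Longrightarrow> F \<inter> H \<subseteq> G" by auto
        from leaf_order.insert[OF \<open>leaf_order (Q - {F})\<close> this]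
        show ?thesis using F(1) by (simp add: insert_absorb)
      qed
    qed (simp add: leaf_order.empty)
  qed
  then show ?thesis by simp
qed

text \<open>This is Mayer-Vietoris done by hand: the new member \<open>F\<close> meets the older
  complex inside the simplex \<open>F \<inter> G\<close>, where the boundary of one part of a cycle
  can be filled. In degree 1 this breaks down when \<open>F\<close> is disjoint from the
  rest.\<close>

lemma leaf_order_acyclic_at:
  assumes "leaf_order Q" "finite V" "\<And>F. F \<in> Q \<Longrightarrow> F \<subseteq> V" "d \<ge> 2"
  shows "acyclic_at TYPE('k::comm_ring_1) V (generated_complex Q) d"
proof -
  \<comment> \<open>The empty set can occur as a member after restriction; its only face has
    cardinality 0, below the degrees considered.\<close>
  have simplex: "acyclic_at TYPE('k) V (Pow F) d" if "F \<subseteq> V" for F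
  proof (cases "F = {}")
    case True
    then show ?thesis using \<open>d \<ge> 2\<close> by (intro acyclic_at_no_faces) auto
  qed (use that acyclic_at_simplex assms(2) in auto)
  show ?thesis
    using assms(1,3)
  proof (induction rule: leaf_order.induct)
    case empty
    show ?case by (rule acyclic_at_no_faces) (simp add: generated_complex_def)
  next
    case (single F)
    have "generated_complex {F} = Pow F" by (auto simp: generated_complex_def)
    then show ?case using simplex[of F] single by simp
  next
    case (insert Q G F)
    obtain e where e: "d = Suc e" "e \<ge> 1" using \<open>d \<ge> 2\<close> by (cases d) auto
    have FV: "F \<subseteq> V" and QV: "\<And>H. H \<in> Q \<Longrightarrow> H \<subseteq> V"
      using insert.prems insert.hyps by auto
    have finV: "finite A" if "A \<subseteq> V" for A using that assms(2) finite_subset by blast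
    have IH: "acyclic_at TYPE('k) V (generated_complex Q) d" using insert.IH QV by blast
    let ?K = "generated_complex (insert F Q)"
    show ?case
      unfolding acyclic_at_def
    proof (intro ballI impI)
      fix f :: "nat set \<Rightarrow> 'k"
      assume f: "f \<in> scalar_chains ?K d" and cyc: "\<forall>B. boundary_in V f B = 0"
      \<comment> \<open>All faces inside \<open>F\<close> go to \<open>f1\<close>, including those
        shared with \<open>Q\<close>, so every face left in \<open>f2\<close> lies in a member of
        \<open>Q\<close>.\<close>
      define f1 where "f1 = (\<lambda>A. if A \<subseteq> F then f A else 0)"
      define f2 where "f2 = (\<lambda>A. if A \<subseteq> F then 0 else f A)"
      have f12: "f = (\<lambda>A. f1 A + f2 A)" by (auto simp: f1_def f2_def)
      have f1: "f1 \<in> scalar_chains (Pow F) d" and f2: "f2 \<in> scalar_chains (generated_complex Q) d"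
        using f by (auto simp: scalar_chains_def f1_def f2_def generated_complex_def)
      define z where "z = boundary_in V f1"
      have z2: "z B = - boundary_in V f2 B" for B
        using cyc boundary_in_add[of V f1 f2 B]
        unfolding z_def f12[symmetric] by (simp add: eq_neg_iff_add_eq_0)
      have "z \<in> scalar_chains (Pow F) e"
        unfolding z_def using FV finV by (intro boundary_in_scalar_chains f1[unfolded e]) auto
      moreover have "boundary_in V f2 \<in> scalar_chains (generated_complex Q) e"
      proof (intro boundary_in_scalar_chains f2[unfolded e])
        show "finite A" if "A \<in> generated_complex Q" for A
          using that QV finV unfolding generated_complex_def by blast
      qed (auto simp: generated_complex_def)
      \<comment> \<open>Up to sign \<open>z\<close> is the boundary of both parts, so a face in its
        support lies in \<open>F\<close> and in some \<open>H\<close> of \<open>Q\<close>, hence in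
        \<open>G\<close>.\<close>
      ultimately have "B \<subseteq> F \<inter> G \<and> card B = e" if "z B \<noteq> 0" for B
      proof -
        have "B \<subseteq> F" "card B = e"
          using scalar_chainsD[OF \<open>z \<in> scalar_chains (Pow F) e\<close> that] by auto
        moreover have "boundary_in V f2 B \<noteq> 0" using that z2[of B] by simp
        from scalar_chainsD(1)[OF \<open>boundary_in V f2 \<in> _\<close> this]
        obtain H where "H \<in> Q" "B \<subseteq> H" by (auto simp: generated_complex_def)
        ultimately show ?thesis using insert.hyps(3) by blast
      qed
      then have z: "z \<in> scalar_chains (Pow (F \<inter> G)) e"
        unfolding scalar_chains_def by blast
      \<comment> \<open>If the intersection is empty, then \<open>z = 0\<close> because its degree
        \<open>e\<close> is at least 1; otherwise the simplex is acyclic.\<close>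
      obtain w where w: "w \<in> scalar_chains (Pow (F \<inter> G)) d" "\<And>B. boundary_in V w B = z B"
      proof (cases "F \<inter> G = {}")
        case True
        then have "z B = 0" for B using z e(2) by (auto simp: scalar_chains_def)
        then show ?thesis
          by (intro that[of "\<lambda>_. 0"]) (auto simp: boundary_in_def scalar_chains_def)
      next
        case False
        have "acyclic_at TYPE('k) V (Pow (F \<inter> G)) e"
          using FV False by (intro acyclic_at_simplex assms(2)) auto
        moreover have "\<forall>B. boundary_in V z B = 0"
          unfolding z_def using boundary_in_boundary_in[OF assms(2)] by blast
        ultimately show ?thesis using z that unfolding acyclic_at_def e(1) by blast
      qed
      have "w \<in> scalar_chains (Pow F) d" "w \<in> scalar_chains (generated_complex Q) d"
        using insert.hyps(2)
        by (auto intro!: scalar_chains_mono[OF w(1)] simp: generated_complex_def)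
      note w' = this
      \<comment> \<open>Moving \<open>w\<close> from \<open>f1\<close> to \<open>f2\<close> turns
        both parts into cycles and keeps their sum.\<close>
      have "boundary_in V (\<lambda>A. f1 A - w A) B = 0" for B
        using w(2)[of B] by (simp add: boundary_in_diff z_def)
      from acyclic_atE[OF simplex[OF FV] scalar_chains_diff[OF f1 w'(1)] this]
      obtain g1 where g1: "g1 \<in> scalar_chains (Pow F) (Suc d)"
        "\<And>B. boundary_in V g1 B = f1 B - w B" by blast
      have "boundary_in V (\<lambda>A. f2 A + w A) B = 0" for B
        using w(2)[of B] z2[of B] by (simp add: boundary_in_add)
      from acyclic_atE[OF IH scalar_chains_add[OF f2 w'(2)] this]
      obtain g2 where g2: "g2 \<in> scalar_chains (generated_complex Q) (Suc d)"
        "\<And>B. boundary_in V g2 B = f2 B + w B" by blast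
      show "\<exists>g\<in>scalar_chains ?K (Suc d). \<forall>B. boundary_in V g B = f B"
      proof (intro bexI allI)
        show "boundary_in V (\<lambda>A. g1 A + g2 A) B = f B" for B
          using g1(2) g2(2) by (simp add: boundary_in_add f12)
        show "(\<lambda>A. g1 A + g2 A) \<in> scalar_chains ?K (Suc d)"
          by (intro scalar_chains_add scalar_chains_mono[OF g1(1)] scalar_chains_mono[OF g2(1)])
            (auto simp: generated_complex_def)
      qed
    qed
  qed
qed


section \<open>Connectedness as exactness at the vertices\<close>

text \<open>In degree 1 the boundary is the augmentation: the sum of the coefficients, placed at the
  empty face.\<close>

lemma boundary_in_degree_1:
  fixes f :: "nat set \<Rightarrow> 'k::comm_ring_1"
  assumes "f \<in> scalar_chains K 1"
  shows "boundary_in V f B = (if B = {} then \<Sum>v\<in>V. f {v} else 0)"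
proof (cases "B = {}")
  case True
  then show ?thesis by (simp add: boundary_in_def face_sign_def)
next
  case False
  have "f (insert i B) = 0" if "i \<notin> B" for i
  proof (rule ccontr)
    assume "f (insert i B) \<noteq> 0"
    then have c: "card (insert i B) = 1" using scalar_chainsD[OF assms] by blast
    \<comment> \<open>An infinite set has \<open>card\<close> equal to \<open>0\<close>, so the
      value 1 also excludes infinite \<open>B\<close>.\<close>
    then have "finite B" by (metis card.infinite finite_insert zero_neq_one)
    then show False using c that False by simp
  qed
  then show ?thesis using False by (simp add: boundary_in_def)
qed

text \<open>The coefficients of a cycle sum to \<open>0\<close>, so the cycle is a combination of
  differences \<open>\<delta> v - \<delta> u\<close> with a fixed base vertex \<open>u\<close>, and
  each difference is the boundary of a path from \<open>u\<close> to \<open>v\<close>.\<close>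

lemma connected_imp_acyclic_at_1:
  assumes "finite V" "K \<subseteq> Pow V" "\<forall>A\<in>K. Pow A \<subseteq> K"
    and "connected_complex K"
  shows "acyclic_at TYPE('k::comm_ring_1) V K 1"
proof -
  define \<delta> :: "nat \<Rightarrow> nat set \<Rightarrow> 'k" where "\<delta> = (\<lambda>v A. if A = {v} then 1 else 0)"
  \<comment> \<open>Acyclicity of the simplex \<open>{u, v}\<close> provides the filling and covers
    the orientation of the edge and the case \<open>u = v\<close> at once.\<close>
  have edge: "\<exists>g \<in> scalar_chains K 2. \<forall>B. boundary_in V g B = \<delta> v B - \<delta> u B"
    if "{u, v} \<in> K" for u v
  proof -
    have uv: "{u, v} \<subseteq> V" using that assms(2) by auto
    have ch: "(\<lambda>A. \<delta> v A - \<delta> u A) \<in> scalar_chains (Pow {u, v}) 1"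
      by (auto simp: scalar_chains_def \<delta>_def)
    have "boundary_in V (\<lambda>A. \<delta> v A - \<delta> u A) B = 0" for B
      unfolding boundary_in_degree_1[OF ch] using uv assms(1)
      by (simp add: sum_subtractf \<delta>_def)
    moreover have "acyclic_at TYPE('k) V (Pow {u, v}) 1"
      using uv by (intro acyclic_at_simplex assms(1)) auto
    ultimately obtain g where "g \<in> scalar_chains (Pow {u, v}) (Suc 1)"
        "\<And>B. boundary_in V g B = \<delta> v B - \<delta> u B"
      using acyclic_atE[OF _ ch] by metis
    moreover have "Pow {u, v} \<subseteq> K" using assms(3) that by blast
    ultimately show ?thesis using scalar_chains_mono by (metis Suc_1)
  qed
  have path: "\<exists>g \<in> scalar_chains K 2. \<forall>B. boundary_in V g B = \<delta> v B - \<delta> u B"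
    if "(u, v) \<in> {(a, b). {a, b} \<in> K}\<^sup>*" for u v
    using that
  proof (induction rule: rtrancl_induct)
    case base
    show ?case by (rule bexI[of _ "\<lambda>_. 0"]) (auto simp: boundary_in_def scalar_chains_def)
  next
    case (step v w)
    then obtain g h where g: "g \<in> scalar_chains K 2" "\<And>B. boundary_in V g B = \<delta> v B - \<delta> u B"
      and h: "h \<in> scalar_chains K 2" "\<And>B. boundary_in V h B = \<delta> w B - \<delta> v B"
      using edge[of v w] by auto
    then have "\<forall>B. boundary_in V (\<lambda>A. g A + h A) B = \<delta> w B - \<delta> u B"
      by (simp add: boundary_in_add)
    then show ?case using scalar_chains_add[OF g(1) h(1)] by blast
  qed
  show ?thesis
    unfolding acyclic_at_def
  proof (intro ballI impI)
    fix f :: "nat set \<Rightarrow> 'k"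
    assume f: "f \<in> scalar_chains K 1" and cyc: "\<forall>B. boundary_in V f B = 0"
    have sum0: "(\<Sum>v\<in>V. f {v}) = 0" using cyc boundary_in_degree_1[OF f, of V "{}"] by simp
    have singl: "\<exists>v\<in>V. A = {v} \<and> {v} \<in> K" if "f A \<noteq> 0" for A
      using scalar_chainsD[OF f that] assms(2) by (auto simp: card_1_singleton_iff)
    define S where "S = {v \<in> V. {v} \<in> K}"
    have finS: "finite S" using assms(1) by (simp add: S_def)
    have f_eq: "f B = (\<Sum>v\<in>S. f {v} * \<delta> v B)" for B
    proof (cases "\<exists>v. B = {v}")
      case True
      then obtain v where B: "B = {v}" by blast
      have "(\<Sum>v\<in>S. f {v} * \<delta> v B) = (\<Sum>w\<in>S. if w = v then f {v} else 0)"
        by (rule sum.cong) (auto simp: B \<delta>_def)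
      also have "\<dots> = f B" using singl[of B] finS by (auto simp: B S_def)
      finally show ?thesis by simp
    next
      case False
      then show ?thesis using singl[of B] by (auto simp: \<delta>_def)
    qed
    have sumS: "(\<Sum>v\<in>S. f {v}) = 0"
      unfolding sum0[symmetric] using singl assms(1)
      by (intro sum.mono_neutral_left) (auto simp: S_def)
    show "\<exists>g\<in>scalar_chains K (Suc 1). \<forall>B. boundary_in V g B = f B"
    proof (cases "S = {}")
      case True
      then have "f B = 0" for B using f_eq by simp
      then show ?thesis
        by (intro bexI[of _ "\<lambda>_. 0"]) (auto simp: boundary_in_def scalar_chains_def)
    next
      case False
      then obtain u where u: "u \<in> S" by auto
      have "\<forall>v\<in>S. \<exists>g. g \<in> scalar_chains K 2 \<and> (\<forall>B. boundary_in V g B = \<delta> v B - \<delta> u B)"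
        using path u assms(4) unfolding S_def connected_complex_def by blast
      then obtain g where g: "\<And>v. v \<in> S \<Longrightarrow> g v \<in> scalar_chains K 2"
        "\<And>v B. v \<in> S \<Longrightarrow> boundary_in V (g v) B = \<delta> v B - \<delta> u B" by metis
      show ?thesis
      proof (intro bexI allI)
        fix B
        have "boundary_in V (\<lambda>A. \<Sum>v\<in>S. f {v} * g v A) B =
            (\<Sum>v\<in>S. f {v} * (\<delta> v B - \<delta> u B))"
          by (simp add: boundary_in_sum g(2))
        \<comment> \<open>The base vertex is multiplied by the augmentation of \<open>f\<close>,
          which is \<open>0\<close>.\<close>
        also have "\<dots> = (\<Sum>v\<in>S. f {v} * \<delta> v B) - (\<Sum>v\<in>S. f {v}) * \<delta> u B"
          by (simp add: right_diff_distrib sum_subtractf sum_distrib_right)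
        finally show "boundary_in V (\<lambda>A. \<Sum>v\<in>S. f {v} * g v A) B = f B"
          by (simp add: sumS f_eq[symmetric])
      next
        have "A \<in> K \<and> card A = 2" if nz: "(\<Sum>v\<in>S. f {v} * g v A) \<noteq> 0" for A
        proof -
          obtain v where "v \<in> S" "f {v} * g v A \<noteq> 0" 
            using sum.not_neutral_contains_not_neutral[OF nz] by blast
          then have "g v A \<noteq> 0" by auto
          then show ?thesis using scalar_chainsD[OF g(1)[OF \<open>v \<in> S\<close>]] by blast
        qed
        then show "(\<lambda>A. \<Sum>v\<in>S. f {v} * g v A) \<in> scalar_chains K (Suc 1)"
          by (simp add: scalar_chains_def)
      qed
    qed
  qed
qed

text \<open>Fill the difference of the vertices \<open>v\<close> and \<open>u\<close> by
  \<open>g\<close> and sum its boundary over the component \<open>C\<close> of \<open>u\<close>. No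
  edge leaves \<open>C\<close>, and the two ends of each edge inside contribute opposite values, so
  the sum is \<open>0\<close>.\<close>

lemma acyclic_at_1_imp_connected:
  assumes "finite V" "K \<subseteq> Pow V" "acyclic_at TYPE('k::comm_ring_1) V K 1"
  shows "connected_complex K"
  unfolding connected_complex_def
proof (intro allI impI)
  fix u v assume uv: "{u} \<in> K" "{v} \<in> K"
  define R where "R = {(a, b). {a, b} \<in> K}"
  define C where "C = {x \<in> V. (u, x) \<in> R\<^sup>*}"
  define f :: "nat set \<Rightarrow> 'k" where
    "f = (\<lambda>A. (if A = {v} then 1 else 0) - (if A = {u} then 1 else 0))"
  have uvV: "u \<in> V" "v \<in> V" using uv assms(2) by auto
  have f: "f \<in> scalar_chains K 1" using uv by (auto simp: scalar_chains_def f_def)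
  have "boundary_in V f B = 0" for B
    unfolding boundary_in_degree_1[OF f] using uvV assms(1) by (simp add: f_def sum_subtractf)
  from acyclic_atE[OF assms(3) f this] obtain g where
    g: "g \<in> scalar_chains K (Suc 1)" "\<And>B. boundary_in V g B = f B" by blast
  have "finite C" using assms(1) by (simp add: C_def)
  have closed: "g {i, x} = 0" if "x \<in> C" "i \<in> V - C" for x i
  proof (rule ccontr)
    assume "g {i, x} \<noteq> 0"
    then have "(x, i) \<in> R" using scalar_chainsD(1)[OF g(1)] by (auto simp: R_def insert_commute)
    then show False using that rtrancl_into_rtrancl[of u x R i] by (simp add: C_def)
  qed
  have "(\<Sum>x\<in>C. f {x}) = (\<Sum>x\<in>C. \<Sum>i\<in>C - {x}. face_sign i {x} * g {i, x})"
  proof (rule sum.cong)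
    fix x assume x: "x \<in> C"
    have "f {x} = (\<Sum>i\<in>V - {x}. face_sign i {x} * g {i, x})"
      unfolding g(2)[symmetric] boundary_in_def ..
    also have "\<dots> = (\<Sum>i\<in>C - {x}. face_sign i {x} * g {i, x})"
    proof (rule sum.mono_neutral_right)
      show "\<forall>i\<in>V - {x} - (C - {x}). face_sign i {x} * g {i, x} = 0"
      proof
        fix i assume "i \<in> V - {x} - (C - {x})"
        then have "g {i, x} = 0" by (intro closed x) auto
        then show "face_sign i {x} * g {i, x} = 0" by simp
      qed
    qed (use assms(1) in \<open>auto simp: C_def\<close>)
    finally show "f {x} = \<dots>" .
  qed simp
  also have "\<dots> = 0"
  proof (rule sum_antisymmetric[OF \<open>finite C\<close>])
    fix i j :: nat assume "i \<noteq> j"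
    then show "face_sign j {i} * g {j, i} = - (face_sign i {j} * g {i, j})"
      using face_sign_swap[of i "{}" j, where 'a='k]
      by (simp add: insert_commute face_sign_def)
  qed
  finally have "(\<Sum>x\<in>C. f {x}) = 0" .
  \<comment> \<open>As \<open>u\<close> lies in \<open>C\<close> and \<open>1 \<noteq> 0\<close>,
    the vanishing sum forces \<open>v\<close> into \<open>C\<close>.\<close>
  moreover have "(\<Sum>x\<in>C. f {x}) = (if v \<in> C then 1 else 0) - (if u \<in> C then 1 else 0)"
    using \<open>finite C\<close> by (simp add: f_def sum_subtractf)
  moreover have "u \<in> C" using uvV by (simp add: C_def)
  ultimately have "v \<in> C" by (auto split: if_splits)
  then show "(u, v) \<in> {(a, b). {a, b} \<in> K}\<^sup>*" by (simp add: C_def R_def)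
qed


section \<open>Multidegrees\<close>

text \<open>Divisibility of monomials without a coefficient ring, so that conditions on multidegrees
  do not involve its type.\<close>

definition exp_le :: "'x monomial \<Rightarrow> 'x monomial \<Rightarrow> bool" where
  "exp_le u v \<longleftrightarrow> (\<forall>x. Poly_Mapping.lookup u x \<le> Poly_Mapping.lookup v x)"

lemma monom_dvd_iff_exp_le:
  "(monom u :: ('x, 'k::comm_ring_1) polynomial) dvd monom v \<longleftrightarrow> exp_le u v"
  by (simp add: monom_dvd_iff exp_le_def)

lemma exp_le_refl [simp]: "exp_le u u"
  by (simp add: exp_le_def)

lemma exp_le_trans: "exp_le u v \<Longrightarrow> exp_le v w \<Longrightarrow> exp_le u w"
  unfolding exp_le_def using order_trans by blast

lemma exp_le_add [simp]: "exp_le u (u + v)" "exp_le u (v + u)"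
  by (simp_all add: exp_le_def lookup_add)

lemma exp_le_add_diff: "exp_le u v \<Longrightarrow> u + (v - u) = v"
  by (rule poly_mapping_eqI) (simp add: exp_le_def lookup_add lookup_minus)

lemma add_eq_iff_exp_le: "a + w = u \<longleftrightarrow> exp_le w u \<and> a = u - w"
  by (metis add.commute add_diff_cancel_left' exp_le_add(1) exp_le_add_diff)

lemma lcm_label_le_iff:
  assumes "finite A"
  shows "exp_le (lcm_label \<mu> A) m \<longleftrightarrow> (\<forall>i\<in>A. exp_le (\<mu> i) m)"
  \<comment> \<open>The claim does not mention a coefficient ring; \<open>int\<close> is an
    arbitrary choice.\<close>
  using lcm_label_dvd_iff[OF assms, of \<mu> m, where 'k=int] by (simp add: monom_dvd_iff_exp_le)

lemma lcm_label_mono: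
  assumes "finite A" "B \<subseteq> A"
  shows "exp_le (lcm_label \<mu> B) (lcm_label \<mu> A)"
proof -
  have "\<forall>i\<in>A. exp_le (\<mu> i) (lcm_label \<mu> A)"
    using lcm_label_le_iff[OF assms(1), of \<mu> "lcm_label \<mu> A"] by simp
  then show ?thesis
    using lcm_label_le_iff[of B \<mu> "lcm_label \<mu> A"] assms finite_subset by blast
qed

lemma lookup_mult_monom:
  fixes p :: "('x, 'k::comm_ring_1) polynomial"
  shows "Poly_Mapping.lookup (p * monom w) u =
    (if exp_le w u then Poly_Mapping.lookup p (u - w) else 0)"
proof -
  have "p = (\<Sum>a\<in>Poly_Mapping.keys p. Poly_Mapping.single a (Poly_Mapping.lookup p a))"
    by (rule poly_mapping_eqI) (auto simp: lookup_sum lookup_single when_def in_keys_iff)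
  then have "p * monom w =
      (\<Sum>a\<in>Poly_Mapping.keys p. Poly_Mapping.single (a + w) (Poly_Mapping.lookup p a))"
    unfolding monom_def by (metis (no_types, lifting) mult.right_neutral mult_single sum.cong
        sum_distrib_right)
  then have eq: "Poly_Mapping.lookup (p * monom w) u =
      (\<Sum>a\<in>Poly_Mapping.keys p. if a + w = u then Poly_Mapping.lookup p a else 0)"
    by (simp add: lookup_sum lookup_single when_def)
  show ?thesis
    unfolding eq add_eq_iff_exp_le by (simp add: in_keys_iff)
qed

text \<open>The sign is a polynomial on the left and a scalar on the right.\<close>

lemma lookup_mult_face_sign:
  fixes p q :: "('x, 'k::comm_ring_1) polynomial"
  shows "Poly_Mapping.lookup (p * (face_sign i A * q)) u =
    face_sign i A * Poly_Mapping.lookup (p * q) u"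
  by (simp add: face_sign_def minus_one_power_iff)

text \<open>Collecting the pairs \<open>A\<close>, \<open>i\<close> with \<open>A - {i} = B\<close>
  turns the sum over removed vertices into one over the cofaces of \<open>B\<close>, the form of
  \<open>boundary_in\<close>.\<close>

lemma lookup_boundary:
  fixes c :: "nat set \<Rightarrow>\<^sub>0 ('x, 'k::comm_ring_1) polynomial"
  assumes "finite V" "Poly_Mapping.keys c \<subseteq> Pow V"
  shows "Poly_Mapping.lookup (boundary \<mu> c) B =
    (\<Sum>i\<in>V - B. Poly_Mapping.lookup c (insert i B) *
       (face_sign i B * monom (lcm_label \<mu> (insert i B) - lcm_label \<mu> B)))"
proof -
  define X :: "nat set \<Rightarrow> nat \<Rightarrow> ('x, 'k) polynomial" where
    "X = (\<lambda>A i. Poly_Mapping.lookup c A *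
       (face_sign i A * monom (lcm_label \<mu> A - lcm_label \<mu> (A - {i}))))"
  have "Poly_Mapping.lookup (boundary \<mu> c) B =
      (\<Sum>A\<in>Poly_Mapping.keys c. \<Sum>i\<in>A. if A - {i} = B then X A i else 0)"
    unfolding boundary_def X_def by (simp add: lookup_sum lookup_single when_def)
  also have "\<dots> = (\<Sum>A\<in>Poly_Mapping.keys c. \<Sum>i\<in>V - B. if A = insert i B then X A i else 0)"
  proof (rule sum.cong)
    fix A assume "A \<in> Poly_Mapping.keys c"
    then have "A \<subseteq> V" using assms(2) by auto
    then show "(\<Sum>i\<in>A. if A - {i} = B then X A i else 0) =
        (\<Sum>i\<in>V - B. if A = insert i B then X A i else 0)"
      using assms(1) finite_subset[of A V]
      by (intro sum.mono_neutral_cong) auto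
  qed simp
  also have "\<dots> = (\<Sum>i\<in>V - B. \<Sum>A\<in>Poly_Mapping.keys c. if A = insert i B then X A i else 0)"
    by (rule sum.swap)
  also have "\<dots> = (\<Sum>i\<in>V - B. X (insert i B) i)"
    by (rule sum.cong) (auto simp: X_def in_keys_iff)
  also have "\<dots> = (\<Sum>i\<in>V - B. Poly_Mapping.lookup c (insert i B) *
       (face_sign i B * monom (lcm_label \<mu> (insert i B) - lcm_label \<mu> B)))"
    by (rule sum.cong) (auto simp: X_def)
  finally show ?thesis .
qed

text \<open>
  The coefficients of a chain in multidegree \<open>m\<close>; conversely, \<open>homogeneous_chain\<close> places
  given coefficients in multidegree \<open>m\<close>. Where \<open>m\<close> is not a multiple of the label of \<open>A\<close>, the
  difference \<open>m - lcm_label \<mu> A\<close> is truncated and the value \<open>f A\<close> has to be \<open>0\<close>.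
\<close>

definition component ::
    "(nat \<Rightarrow> 'x monomial) \<Rightarrow> 'x monomial \<Rightarrow> (nat set \<Rightarrow>\<^sub>0 ('x, 'k::comm_ring_1) polynomial)
       \<Rightarrow> nat set \<Rightarrow> 'k" where
  "component \<mu> m c A = (if exp_le (lcm_label \<mu> A) m
     then Poly_Mapping.lookup (Poly_Mapping.lookup c A) (m - lcm_label \<mu> A) else 0)"

definition homogeneous_chain ::
    "nat set \<Rightarrow> (nat \<Rightarrow> 'x monomial) \<Rightarrow> 'x monomial \<Rightarrow> (nat set \<Rightarrow> 'k)
       \<Rightarrow> (nat set \<Rightarrow>\<^sub>0 ('x, 'k::comm_ring_1) polynomial)" where
  "homogeneous_chain V \<mu> m f =
     (\<Sum>A\<in>Pow V. Poly_Mapping.single A (Poly_Mapping.single (m - lcm_label \<mu> A) (f A)))"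

section \<open>Passing between chains and their homogeneous components\<close>

lemma component_sum: "component \<mu> m (sum c M) A = (\<Sum>j\<in>M. component \<mu> m (c j) A)"
  by (cases "exp_le (lcm_label \<mu> A) m") (simp_all add: component_def lookup_sum)

text \<open>The coefficient of the monomial \<open>u\<close> at the face \<open>A\<close> shows up
  in multidegree \<open>lcm_label \<mu> A + u\<close>, so the components determine the
  chain.\<close>

lemma chain_eqI:
  assumes "\<And>m A. component \<mu> m c A = component \<mu> m c' A"
  shows "c = c'"
proof (intro poly_mapping_eqI)
  fix A u
  show "Poly_Mapping.lookup (Poly_Mapping.lookup c A) u =
      Poly_Mapping.lookup (Poly_Mapping.lookup c' A) u"
    using assms[of "lcm_label \<mu> A + u" A] by (simp add: component_def)
qed

text \<open>The monomial factor of the differential is the quotient of the two face labels, so it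
  exactly compensates the change of label: multidegrees are preserved and only the sign
  remains.\<close>

lemma component_boundary:
  fixes c :: "nat set \<Rightarrow>\<^sub>0 ('x, 'k::comm_ring_1) polynomial"
  assumes "finite V" "Poly_Mapping.keys c \<subseteq> Pow V"
  shows "component \<mu> m (boundary \<mu> c) B = boundary_in V (component \<mu> m c) B"
proof -
  have "(if exp_le (lcm_label \<mu> B) m
        then Poly_Mapping.lookup (Poly_Mapping.lookup c (insert i B) *
         (face_sign i B * monom (lcm_label \<mu> (insert i B) - lcm_label \<mu> B))) (m - lcm_label \<mu> B)
        else 0) = face_sign i B * component \<mu> m c (insert i B)" for i
  proof (cases "insert i B \<in> Poly_Mapping.keys c")
    case True
    then have "finite (insert i B)" using assms(2) by (intro finite_subset[OF _ assms(1)]) auto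
    then have le: "exp_le (lcm_label \<mu> B) (lcm_label \<mu> (insert i B))"
      by (intro lcm_label_mono) auto
    show ?thesis
    proof (cases "exp_le (lcm_label \<mu> B) m")
      case Bm: True
      have "exp_le (lcm_label \<mu> (insert i B) - lcm_label \<mu> B) (m - lcm_label \<mu> B) \<longleftrightarrow>
          exp_le (lcm_label \<mu> (insert i B)) m"
        using le Bm by (simp add: exp_le_def lookup_minus le_diff_iff)
      moreover have "m - lcm_label \<mu> B - (lcm_label \<mu> (insert i B) - lcm_label \<mu> B) =
          m - lcm_label \<mu> (insert i B)"
        using le by (intro poly_mapping_eqI) (simp add: exp_le_def lookup_minus)
      ultimately show ?thesis
        using Bm by (simp add: lookup_mult_face_sign lookup_mult_monom component_def)
    next
      case False
      \<comment> \<open>A larger face has a larger label, so both sides are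
        \<open>0\<close>.\<close>
      then have "\<not> exp_le (lcm_label \<mu> (insert i B)) m" using le exp_le_trans by blast
      then show ?thesis using False by (simp add: component_def)
    qed
  qed (simp add: in_keys_iff component_def)
  moreover have "component \<mu> m (boundary \<mu> c) B = (\<Sum>i\<in>V - B. if exp_le (lcm_label \<mu> B) m
        then Poly_Mapping.lookup (Poly_Mapping.lookup c (insert i B) *
         (face_sign i B * monom (lcm_label \<mu> (insert i B) - lcm_label \<mu> B))) (m - lcm_label \<mu> B)
        else 0)"
    by (cases "exp_le (lcm_label \<mu> B) m")
      (simp_all add: component_def lookup_boundary[OF assms] lookup_sum)
  ultimately show ?thesis by (simp add: boundary_in_def)
qed

text \<open>This is \<open>\<Delta>\<^sub>m\<close>, described by the labels of faces, which are
  what \<open>component\<close> tests.\<close>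

abbreviation faces_below :: "nat set set \<Rightarrow> (nat \<Rightarrow> 'x monomial) \<Rightarrow> 'x monomial \<Rightarrow> nat set set" where
  "faces_below \<Delta> \<mu> m \<equiv> {A \<in> \<Delta>. exp_le (lcm_label \<mu> A) m}"

lemma chainsD:
  assumes "c \<in> chains \<Delta> d" "Poly_Mapping.lookup c A \<noteq> 0"
  shows "A \<in> \<Delta>" "card A = d"
  using assms by (auto simp: chains_def in_keys_iff)

lemma component_in_scalar_chains:
  assumes "c \<in> chains \<Delta> d"
  shows "component \<mu> m c \<in> scalar_chains (faces_below \<Delta> \<mu> m) d"
  unfolding scalar_chains_def
proof (clarify)
  fix A assume "component \<mu> m c A \<noteq> 0"
  then have "exp_le (lcm_label \<mu> A) m" "Poly_Mapping.lookup c A \<noteq> 0"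
    by (auto simp: component_def split: if_splits)
  then show "A \<in> faces_below \<Delta> \<mu> m \<and> card A = d" using chainsD[OF assms] by blast
qed

lemma lookup_homogeneous_chain:
  assumes "finite V"
  shows "Poly_Mapping.lookup (homogeneous_chain V \<mu> m f) A =
    (if A \<subseteq> V then Poly_Mapping.single (m - lcm_label \<mu> A) (f A) else 0)"
  using assms by (simp add: homogeneous_chain_def lookup_sum lookup_single when_def)

lemma homogeneous_chain_in_chains:
  assumes "finite V" "f \<in> scalar_chains (faces_below \<Delta> \<mu> m) d"
  shows "homogeneous_chain V \<mu> m f \<in> chains \<Delta> d"
proof -
  have "A \<in> \<Delta> \<and> card A = d" if "A \<in> Poly_Mapping.keys (homogeneous_chain V \<mu> m f)" for A
  proof -
    have "f A \<noteq> 0"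
      using that by (auto simp: in_keys_iff lookup_homogeneous_chain[OF assms(1)] split: if_splits)
    then show ?thesis using scalar_chainsD[OF assms(2)] by blast
  qed
  then show ?thesis by (auto simp: chains_def)
qed

lemma component_homogeneous_chain:
  assumes "finite V" "\<Delta> \<subseteq> Pow V" "f \<in> scalar_chains (faces_below \<Delta> \<mu> m) d"
  shows "component \<mu> m' (homogeneous_chain V \<mu> m f) A = (if m' = m then f A else 0)"
proof (cases "f A = 0")
  case True
  then show ?thesis by (simp add: component_def lookup_homogeneous_chain[OF assms(1)])
next
  case False
  then have A: "exp_le (lcm_label \<mu> A) m" "A \<subseteq> V"
    using scalar_chainsD[OF assms(3) False] assms(2) by auto
  \<comment> \<open>On multiples of the label of \<open>A\<close> no truncation occurs, so
    subtracting that label is injective.\<close>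
  have "m - lcm_label \<mu> A = m' - lcm_label \<mu> A \<longleftrightarrow> m' = m" if "exp_le (lcm_label \<mu> A) m'"
    using exp_le_add_diff[OF A(1)] exp_le_add_diff[OF that] by metis
  then show ?thesis
    using A by (auto simp: component_def lookup_homogeneous_chain[OF assms(1)]
        lookup_single when_def)
qed

text \<open>A scalar cycle of \<open>\<Delta>\<^sub>m\<close> is placed in multidegree
  \<open>m\<close>, and the component of a filling fills it. Conversely, the components of a cycle
  are filled separately and the fillings are added up.\<close>

lemma exact_iff_acyclic_at:
  assumes "finite V" "\<Delta> \<subseteq> Pow V"
  shows "(\<forall>c \<in> chains \<Delta> d. boundary \<mu> c = (0 :: nat set \<Rightarrow>\<^sub>0 ('x, 'k::comm_ring_1) polynomial)
      \<longrightarrow> c \<in> boundary \<mu> ` chains \<Delta> (Suc d)) \<longleftrightarrow>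
    (\<forall>m. acyclic_at TYPE('k) V (faces_below \<Delta> \<mu> m) d)" (is "?exact \<longleftrightarrow> ?acyclic")
proof
  have keys: "Poly_Mapping.keys c \<subseteq> Pow V" if "c \<in> chains \<Delta> e"
    for e and c :: "nat set \<Rightarrow>\<^sub>0 ('x, 'k) polynomial"
    using that assms(2) by (auto simp: chains_def)
  {
    assume exact: ?exact
    show ?acyclic
      unfolding acyclic_at_def
    proof (intro allI ballI impI)
      fix m and f :: "nat set \<Rightarrow> 'k"
      assume f: "f \<in> scalar_chains (faces_below \<Delta> \<mu> m) d" "\<forall>B. boundary_in V f B = 0"
      define c where "c = homogeneous_chain V \<mu> m f"
      have c: "c \<in> chains \<Delta> d"
        unfolding c_def by (rule homogeneous_chain_in_chains[OF assms(1) f(1)])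
      have comp: "component \<mu> m' c = (if m' = m then f else (\<lambda>_. 0))" for m'
        using component_homogeneous_chain[OF assms f(1)] by (auto simp: c_def)
      have "boundary \<mu> c = 0"
      proof (rule chain_eqI)
        show "component \<mu> m' (boundary \<mu> c) A = component \<mu> m' 0 A" for m' A
          unfolding component_boundary[OF assms(1) keys[OF c]] comp
          using f(2) by (simp add: boundary_in_def component_def)
      qed
      then obtain b where b: "b \<in> chains \<Delta> (Suc d)" "c = boundary \<mu> b"
        using exact c by blast
      have "boundary_in V (component \<mu> m b) B = f B" for B
        using component_boundary[OF assms(1) keys[OF b(1)], of \<mu> m B] comp b(2) by simp
      then show "\<exists>g\<in>scalar_chains (faces_below \<Delta> \<mu> m) (Suc d).
          \<forall>B. boundary_in V g B = f B"
        using component_in_scalar_chains[OF b(1)] by blast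
    qed
  }
  {
    assume acyclic: ?acyclic
    show ?exact
    proof (intro ballI impI)
      fix c :: "nat set \<Rightarrow>\<^sub>0 ('x, 'k) polynomial"
      assume c: "c \<in> chains \<Delta> d" "boundary \<mu> c = 0"
      have "\<exists>g\<in>scalar_chains (faces_below \<Delta> \<mu> m) (Suc d).
          \<forall>B. boundary_in V g B = component \<mu> m c B" for m
      proof -
        have "boundary_in V (component \<mu> m c) B = 0" for B
          unfolding component_boundary[OF assms(1) keys[OF c(1)], symmetric] c(2)
          by (simp add: component_def)
        with acyclic component_in_scalar_chains[OF c(1)] show ?thesis
          by (meson acyclic_atE)
      qed
      then obtain g where g: "\<And>m. g m \<in> scalar_chains (faces_below \<Delta> \<mu> m) (Suc d)"
        "\<And>m B. boundary_in V (g m) B = component \<mu> m c B" by metis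
      \<comment> \<open>The finitely many multidegrees that occur in \<open>c\<close>. Elsewhere the
        chosen \<open>g m\<close> is an arbitrary cycle, so the sum defining \<open>b\<close> has to
        leave it out.\<close>
      define M where "M = (\<Union>A\<in>Poly_Mapping.keys c.
        (\<lambda>u. lcm_label \<mu> A + u) ` Poly_Mapping.keys (Poly_Mapping.lookup c A))"
      have "finite M" by (simp add: M_def)
      have notM: "component \<mu> m c A = 0" if "m \<notin> M" for m A
      proof (rule ccontr)
        assume nz: "component \<mu> m c A \<noteq> 0"
        then have le: "exp_le (lcm_label \<mu> A) m"
          and "m - lcm_label \<mu> A \<in> Poly_Mapping.keys (Poly_Mapping.lookup c A)"
          by (auto simp: component_def in_keys_iff split: if_splits)
        moreover from nz have "A \<in> Poly_Mapping.keys c"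
          by (auto simp: component_def in_keys_iff split: if_splits)
        ultimately have "m \<in> M"
          unfolding M_def using exp_le_add_diff[OF le] by force
        then show False using that by simp
      qed
      define b where "b = (\<Sum>m\<in>M. homogeneous_chain V \<mu> m (g m))"
      have b: "b \<in> chains \<Delta> (Suc d)"
        using homogeneous_chain_in_chains[OF assms(1) g(1)] keys_sum
        unfolding b_def chains_def by fast
      have comp: "component \<mu> m b = (if m \<in> M then g m else (\<lambda>_. 0))" for m
        by (rule ext) (simp add: b_def component_sum
            component_homogeneous_chain[OF assms g(1)] \<open>finite M\<close>)
      have "boundary \<mu> b = c"
      proof (rule chain_eqI)
        show "component \<mu> m (boundary \<mu> b) A = component \<mu> m c A" for m A
          unfolding component_boundary[OF assms(1) keys[OF b]] comp
          using g(2) notM by (simp add: boundary_in_def)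
      qed
      then show "c \<in> boundary \<mu> ` chains \<Delta> (Suc d)" using b by blast
    qed
  }
qed

section \<open>The square of the differential, and its image in degree 0\<close>

lemma boundary_in_chains:
  fixes c :: "nat set \<Rightarrow>\<^sub>0 ('x, 'k::comm_ring_1) polynomial"
  assumes "finite V" "\<Delta> \<subseteq> Pow V" "\<forall>A\<in>\<Delta>. Pow A \<subseteq> \<Delta>"
    and "c \<in> chains \<Delta> (Suc d)"
  shows "boundary \<mu> c \<in> chains \<Delta> d"
proof -
  have keys: "Poly_Mapping.keys c \<subseteq> Pow V" using assms(2,4) by (auto simp: chains_def)
  have "B \<in> \<Delta> \<and> card B = d" if "Poly_Mapping.lookup (boundary \<mu> c) B \<noteq> 0" for B
  proof -
    obtain i where i: "i \<in> V - B" "Poly_Mapping.lookup c (insert i B) \<noteq> 0"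
      using \<open>Poly_Mapping.lookup (boundary \<mu> c) B \<noteq> 0\<close>
      unfolding lookup_boundary[OF assms(1) keys]
      by (metis (no_types, lifting) mult_zero_left sum.neutral)
    have "insert i B \<in> \<Delta>" "card (insert i B) = Suc d" using chainsD[OF assms(4) i(2)] by auto
    moreover from this(1) have "B \<in> \<Delta>" using assms(3) by blast
    moreover from this have "finite B" using assms(1,2) finite_subset by blast
    ultimately show ?thesis using i(1) by simp
  qed
  then show ?thesis by (auto simp: chains_def in_keys_iff)
qed

text \<open>On each component this is the corresponding fact for scalar chains.\<close>

lemma boundary_boundary:
  fixes c :: "nat set \<Rightarrow>\<^sub>0 ('x, 'k::comm_ring_1) polynomial"
  assumes "finite V" "\<Delta> \<subseteq> Pow V" "\<forall>A\<in>\<Delta>. Pow A \<subseteq> \<Delta>"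
    and "c \<in> chains \<Delta> (Suc d)"
  shows "boundary \<mu> (boundary \<mu> c) = 0"
proof (rule chain_eqI)
  have "boundary \<mu> c \<in> chains \<Delta> d" by (rule boundary_in_chains[OF assms])
  then have "Poly_Mapping.keys c \<subseteq> Pow V" "Poly_Mapping.keys (boundary \<mu> c) \<subseteq> Pow V"
    using assms(2,4) by (auto simp: chains_def)
  note comp = this[THEN component_boundary[OF assms(1)]]
  have "component \<mu> m (boundary \<mu> c) = boundary_in V (component \<mu> m c)" for m
    by (rule ext) (rule comp(1))
  then show "component \<mu> m (boundary \<mu> (boundary \<mu> c)) A = component \<mu> m 0 A" for m A
    by (simp add: comp(2) boundary_in_boundary_in[OF assms(1)]) (simp add: component_def)
qed

text \<open>The basis element of a vertex \<open>v\<close> is sent to \<open>monom (\<mu> v)\<close>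
  times that of the empty face, so the coefficients reached are the combinations of the
  labels.\<close>

lemma boundary_image_degree_1:
  fixes \<mu> :: "nat \<Rightarrow> 'x monomial"
  assumes "finite V" "\<Delta> \<subseteq> Pow V" "{} \<in> \<Delta>" "\<And>v. v \<in> V \<Longrightarrow> {v} \<in> \<Delta>"
  shows "boundary \<mu> ` chains \<Delta> 1 = {c \<in> chains \<Delta> 0. Poly_Mapping.lookup c {} \<in>
    ideal_generated_by ((\<lambda>i. monom (\<mu> i) :: ('x, 'k::comm_ring_1) polynomial) ` V)}"
    (is "_ = ?R")
proof -
  let ?G = "(\<lambda>i. monom (\<mu> i) :: ('x, 'k) polynomial) ` V"
  have mod: "module ((*) :: ('x, 'k) polynomial \<Rightarrow> _)"
    by unfold_locales (simp_all add: algebra_simps)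
  have lcm_singleton: "lcm_label \<mu> {v} = \<mu> v" for v
    by (rule poly_mapping_eqI) (simp add: lookup_lcm_label)
  have lcm_empty: "lcm_label \<mu> {} = 0" by (simp add: lcm_label_def)
  have boundary_vertices: "Poly_Mapping.lookup (boundary \<mu> c) B =
      (if B = {} then \<Sum>v\<in>V. Poly_Mapping.lookup c {v} * monom (\<mu> v) else 0)"
    if c: "c \<in> chains \<Delta> 1" for B and c :: "nat set \<Rightarrow>\<^sub>0 ('x, 'k) polynomial"
  proof -
    have keys: "Poly_Mapping.keys c \<subseteq> Pow V" using c assms(2) by (auto simp: chains_def)
    show ?thesis
    proof (cases "B = {}")
      case True
      then show ?thesis
        unfolding lookup_boundary[OF assms(1) keys]
        by (simp add: face_sign_def lcm_singleton lcm_empty)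
    next
      case False
      have "Poly_Mapping.lookup c (insert i B) = 0" if "i \<in> V - B" for i
      proof (rule ccontr)
        assume "Poly_Mapping.lookup c (insert i B) \<noteq> 0"
        from chainsD[OF c this] have "card (insert i B) = 1" "insert i B \<subseteq> V"
          using assms(2) by auto
        moreover from this have "finite B" using finite_subset[OF _ assms(1), of B] by simp
        ultimately show False using that False by simp
      qed
      then show ?thesis unfolding lookup_boundary[OF assms(1) keys] using False by simp
    qed
  qed
  have only_empty: "Poly_Mapping.lookup c B = 0" if "c \<in> chains \<Delta> 0" "B \<noteq> {}"
    for c :: "nat set \<Rightarrow>\<^sub>0 ('x, 'k) polynomial" and B
    using chainsD[OF that(1), of B] that(2) assms(1,2) finite_subset[of B V] by auto
  show ?thesis
  proof (intro equalityI subsetI)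
    fix b :: "nat set \<Rightarrow>\<^sub>0 ('x, 'k) polynomial"
    assume "b \<in> boundary \<mu> ` chains \<Delta> 1"
    then obtain c where c: "c \<in> chains \<Delta> 1" "b = boundary \<mu> c" by blast
    have "(\<Sum>v\<in>V. Poly_Mapping.lookup c {v} * monom (\<mu> v)) \<in> ideal_generated_by ?G"
      by (intro module.span_sum[OF mod] module.span_scale[OF mod] module.span_base[OF mod]) auto
    moreover have "b \<in> chains \<Delta> 0"
      using assms(3) boundary_vertices[OF c(1)]
      by (auto simp: c(2) chains_def in_keys_iff split: if_splits)
    ultimately show "b \<in> ?R" using boundary_vertices[OF c(1)] by (simp add: c(2))
  next
    fix b :: "nat set \<Rightarrow>\<^sub>0 ('x, 'k) polynomial"
    assume b: "b \<in> ?R"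
    then have "Poly_Mapping.lookup b {} \<in> ideal_generated_by ?G" by simp
    \<comment> \<open>The coefficients are indexed by vertices, not by generators, because different
      vertices may share a label.\<close>
    then have "\<exists>p. Poly_Mapping.lookup b {} = (\<Sum>v\<in>V. p v * monom (\<mu> v))"
    proof (induction rule: module.span_induct_alt[OF mod, consumes 1])
      case 1
      show ?case by (rule exI[of _ "\<lambda>_. 0"]) simp
    next
      case (2 q x y)
      then obtain w p where w: "w \<in> V" "x = monom (\<mu> w)" "y = (\<Sum>v\<in>V. p v * monom (\<mu> v))"
        by blast
      have "q * x + y = (\<Sum>v\<in>V. (if v = w then q * monom (\<mu> v) else 0) + p v * monom (\<mu> v))"
        using w assms(1) by (simp add: sum.distrib)
      also have "\<dots> = (\<Sum>v\<in>V. ((if v = w then q else 0) + p v) * monom (\<mu> v))"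
        by (rule sum.cong) (auto simp: distrib_right)
      finally show ?case by (rule exI[of _ "\<lambda>v. (if v = w then q else 0) + p v"])
    qed
    then obtain p where p: "Poly_Mapping.lookup b {} = (\<Sum>v\<in>V. p v * monom (\<mu> v))" by blast
    define c where "c = (\<Sum>v\<in>V. Poly_Mapping.single {v} (p v))"
    have lookup_c: "Poly_Mapping.lookup c A =
        (\<Sum>v\<in>V. if A = {v} then p v else 0)" for A
      by (simp add: c_def lookup_sum lookup_single when_def eq_commute)
    have c_vertex: "Poly_Mapping.lookup c {v} = p v" if "v \<in> V" for v
      using that assms(1) by (simp add: lookup_c)
    have "\<exists>v\<in>V. A = {v}" if "Poly_Mapping.lookup c A \<noteq> 0" for A
    proof (rule ccontr)
      assume "\<not> ?thesis"
      then have "Poly_Mapping.lookup c A = 0" by (auto simp: lookup_c intro!: sum.neutral)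
      with that show False by simp
    qed
    then have c: "c \<in> chains \<Delta> 1" using assms(4) by (fastforce simp: chains_def in_keys_iff)
    have "boundary \<mu> c = b"
    proof (rule poly_mapping_eqI)
      show "Poly_Mapping.lookup (boundary \<mu> c) B = Poly_Mapping.lookup b B" for B
        using b only_empty[of b B] boundary_vertices[OF c, of B]
        by (auto simp: p c_vertex)
    qed
    then show "b \<in> boundary \<mu> ` chains \<Delta> 1" using c by blast
  qed
qed


section \<open>The criterion\<close>

theorem theorem3p2:
  fixes \<Delta> :: "nat set set"
    and t :: nat
    and \<mu> :: "nat \<Rightarrow> 'x monomial"
    and I :: "('x, 'k::field) polynomial set"
  assumes "simplicial_tree {1..t} \<Delta>"
    and "I = ideal_generated_by ((\<lambda>i. monom (\<mu> i)) ` {1..t})"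
  shows "is_free_resolution_of_quotient \<Delta> \<mu> I \<longleftrightarrow>
    (\<forall>m :: 'x monomial.
       connected_complex
         (induced_subcomplex \<Delta>
            {i \<in> {1..t}. (monom (\<mu> i) :: ('x, 'k) polynomial) dvd monom m}))"
proof -
  define V where "V = {1..t}"
  have "simplicial_complex V \<Delta>"
    using assms(1) by (simp add: simplicial_tree_def V_def)
  then have \<Delta>: "\<Delta> \<subseteq> Pow V" "\<forall>A\<in>\<Delta>. Pow A \<subseteq> \<Delta>"
    "\<And>v. v \<in> V \<Longrightarrow> {v} \<in> \<Delta>" "{} \<in> \<Delta>"
    unfolding simplicial_complex_def by auto
  have V: "finite V" by (simp add: V_def)
  have fin: "finite A" if "A \<in> \<Delta>" for A using that \<Delta>(1) V finite_subset by blast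
  have "finite \<Delta>" using \<Delta>(1) V by (meson finite_Pow_iff finite_subset)
  note gen = generated_complex_facets[OF this \<Delta>(2)]
  let ?W = "\<lambda>m. {i \<in> V. (monom (\<mu> i) :: ('x, 'k) polynomial) dvd monom m}"
  \<comment> \<open>The lcm of a face divides \<open>m\<close> iff all its vertex labels do.\<close>
  have ind: "induced_subcomplex \<Delta> (?W m) = faces_below \<Delta> \<mu> m" for m
    using \<Delta>(1) lcm_label_le_iff[OF fin] unfolding induced_subcomplex_def monom_dvd_iff_exp_le by blast
  have K: "faces_below \<Delta> \<mu> m \<subseteq> Pow V"
    "\<forall>A\<in>faces_below \<Delta> \<mu> m. Pow A \<subseteq> faces_below \<Delta> \<mu> m" for m
    unfolding ind[symmetric] using \<Delta> by (auto simp: induced_subcomplex_def)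
  have deg1: "connected_complex (faces_below \<Delta> \<mu> m) \<longleftrightarrow>
      acyclic_at TYPE('k) V (faces_below \<Delta> \<mu> m) 1" for m
  proof
    assume "connected_complex (faces_below \<Delta> \<mu> m)"
    then show "acyclic_at TYPE('k) V (faces_below \<Delta> \<mu> m) 1"
      by (rule connected_imp_acyclic_at_1[OF V K])
  qed (rule acyclic_at_1_imp_connected[OF V K(1)])
  have higher: "acyclic_at TYPE('k) V (faces_below \<Delta> \<mu> m) d" if "d \<ge> 2" for m d
  proof -
    \<comment> \<open>These sets generate \<open>\<Delta>\<^sub>m\<close> but need not be its
      facets; \<open>leaf_order\<close> tolerates that.\<close>
    let ?Q = "(\<lambda>F. F \<inter> ?W m) ` facets \<Delta>"
    have "generated_complex ?Q = induced_subcomplex \<Delta> (?W m)"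
      unfolding induced_subcomplex_def
      by (subst gen[symmetric]) (auto simp: generated_complex_def)
    moreover have "leaf_order ?Q"
      using simplicial_tree_leaf_order[OF assms(1)] by (rule leaf_order_restrict)
    then have "acyclic_at TYPE('k) V (generated_complex ?Q) d"
      using V that by (intro leaf_order_acyclic_at) auto
    ultimately show ?thesis by (simp add: ind)
  qed
  have degree_0: "boundary \<mu> ` chains \<Delta> 1 = {c \<in> chains \<Delta> 0. Poly_Mapping.lookup c {} \<in> I}"
    unfolding assms(2) V_def[symmetric] using V \<Delta> by (intro boundary_image_degree_1) auto
  have exact: "{c \<in> chains \<Delta> d. boundary \<mu> c = (0 :: nat set \<Rightarrow>\<^sub>0 ('x, 'k) polynomial)}
        = boundary \<mu> ` chains \<Delta> (d + 1) \<longleftrightarrow>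
      (\<forall>m. acyclic_at TYPE('k) V (faces_below \<Delta> \<mu> m) d)" for d
  proof -
    have "boundary \<mu> ` chains \<Delta> (Suc d) \<subseteq>
        {c \<in> chains \<Delta> d. boundary \<mu> c = (0 :: nat set \<Rightarrow>\<^sub>0 ('x, 'k) polynomial)}"
      using boundary_boundary[OF V \<Delta>(1,2)] boundary_in_chains[OF V \<Delta>(1,2)] by blast
    then show ?thesis
      unfolding exact_iff_acyclic_at[OF V \<Delta>(1), symmetric] by auto
  qed
  have "is_free_resolution_of_quotient \<Delta> \<mu> I \<longleftrightarrow>
      (\<forall>d\<ge>1. \<forall>m. acyclic_at TYPE('k) V (faces_below \<Delta> \<mu> m) d)"
    by (simp only: is_free_resolution_of_quotient_def exact degree_0 simp_thms)
  \<comment> \<open>Degrees from 2 on are settled by \<open>higher\<close>, so only exactness at the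
    vertices, that is connectedness, remains.\<close>
  also have "\<dots> \<longleftrightarrow> (\<forall>m. acyclic_at TYPE('k) V (faces_below \<Delta> \<mu> m) 1)"
  proof
    assume connected: "\<forall>m. acyclic_at TYPE('k) V (faces_below \<Delta> \<mu> m) 1"
    show "\<forall>d\<ge>1. \<forall>m. acyclic_at TYPE('k) V (faces_below \<Delta> \<mu> m) d"
    proof (intro allI impI)
      fix d :: nat and m assume "d \<ge> 1"
      then consider "d = 1" | "d \<ge> 2" by linarith
      then show "acyclic_at TYPE('k) V (faces_below \<Delta> \<mu> m) d"
        using connected higher by cases auto
    qed
  qed simp
  finally show ?thesis
    unfolding V_def[symmetric] ind deg1 .
qed

end
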